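(* Let $f\in C[0,\infty)$, $x\in[0,\infty)$, and suppose that the first and second derivatives of $f\circ\rho^{-1}$ exist at $\rho(x)$. If the second derivative of $f\circ\rho^{-1}$ is bounded on $[0,\infty)$, then $$\lim_{n\to\infty}n\left(V_n^{\rho}(f;x)-f(x)\right)=\frac{1}{2}\rho(x)\left(1+\rho(x)\right)\left(f\circ\rho^{-1}\right)''(\rho(x)).$$
   Context: Let $\rho:[0,\infty)\to\mathbb{R}$ be continuously differentiable on $[0,\infty)$ with $\rho(0)=0$ and $\inf_{x\in[0,\infty)}\rho'(x)\ge 1$ (so $\rho$ is a bijection of $[0,\infty)$ onto itself, with inverse $\rho^{-1}$). For $n\in\mathbb{N}$ ($n\ge 1$), $x\in[0,\infty)$ and $f:[0,\infty)\to\mathbb{R}$ for which the series converges, the generalized Baskakov operator is $$V_n^{\rho}(f;x)=\sum_{k=0}^{\infty}(f\circ\rho^{-1})\left(\frac{k}{n}\right)\binom{n+k-1}{k}\frac{(\rho(x))^k}{(1+\rho(x))^{n+k}} .$$ $C[0,\infty)$ denotes the real-valued continuous functions on $[0,\infty)$. Derivatives at the endpoint $0$ are one-sided. *)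

theory Defs
  imports "HOL-Analysis.Analysis"
begin

text \<open>
  Functions on \<open>[0, \<infinity>)\<close> are total functions on the reals of which only the values on
  \<open>{0..}\<close> matter; accordingly \<open>\<rho>\<inverse>\<close> is taken relative to \<open>{0..}\<close>.  The definition is meant
  for \<open>n \<ge> 1\<close> and \<open>x \<ge> 0\<close>: for \<open>n = 0\<close>, \<open>k / n\<close> is \<open>0\<close> and \<open>n + k - 1\<close> may truncate.
  If the series diverges, the value is unspecified.
\<close>

definition gen_baskakov :: "(real \<Rightarrow> real) \<Rightarrow> nat \<Rightarrow> (real \<Rightarrow> real) \<Rightarrow> real \<Rightarrow> real" where
  "gen_baskakov \<rho> n f x =
     (\<Sum>k. (f \<circ> inv_into {0..} \<rho>) (real k / real n) * real ((n + k - 1) choose k) *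
           (\<rho> x ^ k / (1 + \<rho> x) ^ (n + k)))"

end

theory Submission
  imports Defs
begin

text \<open>
  With \<open>y = \<rho> x\<close> and \<open>g = f \<circ> \<rho>\<inverse>\<close> the operator is the expectation of \<open>g (K / n)\<close>, where \<open>K\<close> has the
  negative binomial distribution with mean \<open>n * y\<close> and variance \<open>n * y * (1 + y)\<close>. Expand \<open>g\<close> to
  second order at \<open>y\<close>: the linear term has expectation \<open>0\<close> and the quadratic one yields the limit.
  The remainder is at most \<open>e * (t - y)\<^sup>2\<close> near \<open>y\<close> and, \<open>g''\<close> being bounded, at most
  \<open>C * (t - y)\<^sup>2\<close> everywhere, hence at most \<open>e * (t - y)\<^sup>2 + D * (t - y) ^ 4\<close>; the fourth central
  moment of \<open>K / n\<close> is \<open>O(1 / n\<^sup>2)\<close>, so \<open>n\<close> times its expectation is negligible.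
\<close>

section \<open>The negative binomial weights and their shift identity\<close>

definition baskakov_weight :: "nat \<Rightarrow> real \<Rightarrow> nat \<Rightarrow> real" where
  "baskakov_weight n y k = real ((n + k - 1) choose k) * (y ^ k / (1 + y) ^ (n + k))"

lemma baskakov_weight_nonneg: "y \<ge> 0 \<Longrightarrow> baskakov_weight n y k \<ge> 0"
  by (simp add: baskakov_weight_def)

text \<open>This is the binomial series with exponent \<open>- n\<close> at
  \<open>z = - (y / (1 + y))\<close>: since \<open>1 + z = 1 / (1 + y)\<close>, it sums to
  \<open>(1 + y) ^ n\<close>, and the sign of the generalized binomial coefficient cancels that of
  \<open>z ^ k\<close>.\<close>

lemma baskakov_weight_sums_1:
  assumes "n \<ge> 1" "y \<ge> 0"
  shows "baskakov_weight n y sums 1"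
proof -
  define z where "z = - (y / (1 + y))"
  have z: "\<bar>z\<bar> < 1" "1 + z = 1 / (1 + y)"
    using assms by (simp_all add: z_def field_simps)
  have "(\<lambda>k. ((- real n) gchoose k) * z ^ k) sums (1 + z) powr (- real n)"
    using gen_binomial_real[OF z(1)] .
  moreover have "(1 + z) powr (- real n) = (1 + y) ^ n"
    using assms by (simp add: z(2) powr_minus powr_realpow power_divide)
  moreover have "((- real n) gchoose k) * z ^ k = baskakov_weight n y k * (1 + y) ^ n" for k
  proof -
    \<comment> \<open>As \<open>n\<close> is at least 1, the natural number subtraction does not
      truncate, even at \<open>k = 0\<close>.\<close>
    have "real n + real k - 1 = real (n + k - 1)"
      using assms by (simp add: of_nat_diff)
    then have "((- real n) gchoose k) = (-1) ^ k * real ((n + k - 1) choose k)"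
      by (simp only: gbinomial_minus[of "real n" k] binomial_gbinomial)
    moreover have "z ^ k = (-1) ^ k * (y ^ k / (1 + y) ^ k)"
      unfolding z_def by (simp only: power_minus[of "y / (1 + y)"] power_divide)
    ultimately show ?thesis
      using assms by (cases "even k") (simp_all add: baskakov_weight_def power_add)
  qed
  ultimately have "(\<lambda>k. baskakov_weight n y k * (1 + y) ^ n) sums (1 * (1 + y) ^ n)"
    by simp
  then show ?thesis
    using assms by (subst (asm) sums_mult2_iff) auto
qed

text \<open>By absorption, (k+1) C(n+k, k+1) = n C(n+k, k), and the exponents n + (k+1) and (n+1) +
  k of \<open>1 + y\<close> agree. A factor k is thus traded for \<open>n * y\<close> and an
  increase of the parameter n by one.\<close>

lemma baskakov_weight_Suc:
  assumes "n \<ge> 1" "y \<ge> 0"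
  shows "baskakov_weight n y (Suc k) * real (Suc k) = real n * y * baskakov_weight (Suc n) y k"
proof -
  have "Suc k * ((n + k) choose Suc k) = n * ((n + k) choose k)"
    using binomial_absorb_comp[of "n + k" k] binomial_absorption[of k "n + k"] assms
    by simp
  then have "real (Suc k) * real ((n + k) choose Suc k) = real n * real ((n + k) choose k)"
    by (metis of_nat_mult)
  moreover have "baskakov_weight n y (Suc k) * real (Suc k)
      = (real (Suc k) * real ((n + k) choose Suc k)) * (y * (y ^ k / (1 + y) ^ (Suc n + k)))"
    by (simp add: baskakov_weight_def)
  ultimately show ?thesis
    by (simp add: baskakov_weight_def)
qed

text \<open>In terms of expectations, E_n[K h(K)] = n y E_{n+1}[h(K+1)]. Each power moment for
  \<open>n\<close> thereby reduces to lower moments for \<open>Suc n\<close>.\<close>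

lemma baskakov_weight_sums_times:
  assumes "n \<ge> 1" "y \<ge> 0" "(\<lambda>k. baskakov_weight (Suc n) y k * h (Suc k)) sums s"
  shows "(\<lambda>k. baskakov_weight n y k * (real k * h k)) sums (real n * y * s)"
proof -
  have "(\<lambda>k. baskakov_weight n y (Suc k) * (real (Suc k) * h (Suc k))) sums (real n * y * s)"
    using sums_mult[OF assms(3), of "real n * y"] baskakov_weight_Suc[OF assms(1,2)]
    by (simp add: mult.assoc[symmetric])
  \<comment> \<open>The factor \<open>real k\<close> kills the term at 0, so undoing the index shift
    leaves the sum unchanged.\<close>
  then show ?thesis
    by (subst (asm) sums_Suc_iff) simp
qed

section \<open>Power moments up to order four\<close>

context
  fixes y :: real
  assumes y: "y \<ge> 0"
begin

lemma baskakov_moment_1: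
  assumes "n \<ge> 1"
  shows "(\<lambda>k. baskakov_weight n y k * real k) sums (real n * y)"
  using baskakov_weight_sums_times[OF assms y, of "\<lambda>_. 1" 1] baskakov_weight_sums_1[of "Suc n" y] y
  by simp

text \<open>The shift identity with \<open>h = real\<close> asks for the mean of K+1 at parameter
  \<open>Suc n\<close>, which the total mass and the first moment supply. The third and fourth
  moments follow the same scheme with h a square and a cube.\<close>

lemma baskakov_moment_2:
  assumes "n \<ge> 1"
  shows "(\<lambda>k. baskakov_weight n y k * real k ^ 2) sums (real n * y * (1 + (real n + 1) * y))"
proof -
  have "(\<lambda>k. baskakov_weight (Suc n) y k + baskakov_weight (Suc n) y k * real k) sums
      (1 + real (Suc n) * y)"
    by (intro sums_add baskakov_weight_sums_1 baskakov_moment_1 y) auto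
  then have "(\<lambda>k. baskakov_weight (Suc n) y k * real (Suc k)) sums (1 + (real n + 1) * y)"
    by (simp add: algebra_simps)
  from baskakov_weight_sums_times[where h = real, OF assms y this] show ?thesis
    by (simp add: power2_eq_square)
qed

lemma baskakov_moment_3:
  assumes "n \<ge> 1"
  shows "(\<lambda>k. baskakov_weight n y k * real k ^ 3) sums
    (real n * y * (1 + 3 * (real n + 1) * y + (real n + 1) * (real n + 2) * y ^ 2))"
proof -
  have "(\<lambda>k. baskakov_weight (Suc n) y k + 2 * (baskakov_weight (Suc n) y k * real k)
      + baskakov_weight (Suc n) y k * real k ^ 2) sums
      (1 + 2 * (real (Suc n) * y) + real (Suc n) * y * (1 + (real (Suc n) + 1) * y))"
    by (intro sums_add sums_mult baskakov_weight_sums_1 baskakov_moment_1 baskakov_moment_2 y) auto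
  then have "(\<lambda>k. baskakov_weight (Suc n) y k * real (Suc k) ^ 2) sums
      (1 + 3 * (real n + 1) * y + (real n + 1) * (real n + 2) * y ^ 2)"
    by (simp add: algebra_simps power2_eq_square)
  from baskakov_weight_sums_times[where h = "\<lambda>k. real k ^ 2", OF assms y this] show ?thesis
    by (simp add: power2_eq_square power3_eq_cube mult.assoc)
qed

lemma baskakov_moment_4:
  assumes "n \<ge> 1"
  shows "(\<lambda>k. baskakov_weight n y k * real k ^ 4) sums
    (real n * y * (1 + 7 * (real n + 1) * y + 6 * (real n + 1) * (real n + 2) * y ^ 2
      + (real n + 1) * (real n + 2) * (real n + 3) * y ^ 3))"
proof -
  \<comment> \<open>The coefficients 1, 3, 3, 1 expand \<open>real (Suc k) ^ 3\<close>.\<close>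
  have "(\<lambda>k. baskakov_weight (Suc n) y k + 3 * (baskakov_weight (Suc n) y k * real k)
      + 3 * (baskakov_weight (Suc n) y k * real k ^ 2) + baskakov_weight (Suc n) y k * real k ^ 3) sums
      (1 + 3 * (real (Suc n) * y) + 3 * (real (Suc n) * y * (1 + (real (Suc n) + 1) * y))
       + real (Suc n) * y * (1 + 3 * (real (Suc n) + 1) * y
           + (real (Suc n) + 1) * (real (Suc n) + 2) * y ^ 2))"
    by (intro sums_add sums_mult baskakov_weight_sums_1 baskakov_moment_1 baskakov_moment_2
        baskakov_moment_3 y) auto
  then have "(\<lambda>k. baskakov_weight (Suc n) y k * real (Suc k) ^ 3) sums
      (1 + 7 * (real n + 1) * y + 6 * (real n + 1) * (real n + 2) * y ^ 2
      + (real n + 1) * (real n + 2) * (real n + 3) * y ^ 3)"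
    by (simp add: algebra_simps power2_eq_square power3_eq_cube)
  from baskakov_weight_sums_times[where h = "\<lambda>k. real k ^ 3", OF assms y this] show ?thesis
    by (simp add: power3_eq_cube power4_eq_xxxx mult.assoc)
qed

section \<open>Central moments of K/n\<close>

lemma baskakov_central_moment_1:
  assumes "n \<ge> 1"
  shows "(\<lambda>k. baskakov_weight n y k * (real k / real n - y)) sums 0"
proof -
  have "(\<lambda>k. baskakov_weight n y k * real k / real n - baskakov_weight n y k * y) sums
      (real n * y / real n - 1 * y)"
    by (intro sums_diff sums_divide sums_mult2 baskakov_weight_sums_1 baskakov_moment_1 assms y)
  then show ?thesis
    using assms by (simp add: algebra_simps)
qed

lemma baskakov_central_moment_2:
  assumes "n \<ge> 1"
  shows "(\<lambda>k. baskakov_weight n y k * (real k / real n - y) ^ 2) sums (y * (1 + y) / real n)"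
proof -
  have "(\<lambda>k. (baskakov_weight n y k * real k ^ 2) / real n ^ 2
      - 2 * y / real n * (baskakov_weight n y k * real k) + y ^ 2 * baskakov_weight n y k) sums
      (real n * y * (1 + (real n + 1) * y) / real n ^ 2 - 2 * y / real n * (real n * y) + y ^ 2 * 1)"
    by (intro sums_add sums_diff sums_divide sums_mult baskakov_weight_sums_1 baskakov_moment_1
        baskakov_moment_2 assms y)
  moreover have "real n * y * (1 + (real n + 1) * y) / real n ^ 2 - 2 * y / real n * (real n * y)
      + y ^ 2 * 1 = y * (1 + y) / real n"
    using assms by (simp add: field_simps power2_eq_square)
  moreover have "(baskakov_weight n y k * real k ^ 2) / real n ^ 2
      - 2 * y / real n * (baskakov_weight n y k * real k) + y ^ 2 * baskakov_weight n y k
      = baskakov_weight n y k * (real k / real n - y) ^ 2" for k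
    using assms by (simp add: field_simps power2_eq_square)
  ultimately show ?thesis
    by simp
qed

lemma baskakov_central_moment_4:
  assumes "n \<ge> 1"
  shows "(\<lambda>k. baskakov_weight n y k * (real k / real n - y) ^ 4) sums
    (y * (1 + y) * (3 * y * (1 + y) / real n ^ 2 + (1 + 6 * y * (1 + y)) / real n ^ 3))"
    (is "_ sums ?s")
proof -
  let ?N = "real n"
  have N: "?N \<noteq> 0"
    using assms by simp
  let ?m1 = "?N * y"
  let ?m2 = "?N * y * (1 + (?N + 1) * y)"
  let ?m3 = "?N * y * (1 + 3 * (?N + 1) * y + (?N + 1) * (?N + 2) * y ^ 2)"
  let ?m4 = "?N * y * (1 + 7 * (?N + 1) * y + 6 * (?N + 1) * (?N + 2) * y ^ 2
      + (?N + 1) * (?N + 2) * (?N + 3) * y ^ 3)"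
  \<comment> \<open>The summands expand the fourth power of \<open>real k - ?N * y\<close>. Pulling
    out the common denominator \<open>?N ^ 4\<close> leaves polynomial identities, which
    \<open>algebra\<close> can settle.\<close>
  have "(\<lambda>k. ((baskakov_weight n y k * real k ^ 4)
      - 4 * ?N * y * (baskakov_weight n y k * real k ^ 3)
      + 6 * ?N ^ 2 * y ^ 2 * (baskakov_weight n y k * real k ^ 2)
      - 4 * ?N ^ 3 * y ^ 3 * (baskakov_weight n y k * real k)
      + ?N ^ 4 * y ^ 4 * baskakov_weight n y k) / ?N ^ 4) sums
      ((?m4 - 4 * ?N * y * ?m3 + 6 * ?N ^ 2 * y ^ 2 * ?m2 - 4 * ?N ^ 3 * y ^ 3 * ?m1
      + ?N ^ 4 * y ^ 4 * 1) / ?N ^ 4)"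
    by (intro sums_add sums_diff sums_divide sums_mult baskakov_weight_sums_1 baskakov_moment_1
        baskakov_moment_2 baskakov_moment_3 baskakov_moment_4 assms y)
  moreover have "(?m4 - 4 * ?N * y * ?m3 + 6 * ?N ^ 2 * y ^ 2 * ?m2 - 4 * ?N ^ 3 * y ^ 3 * ?m1
      + ?N ^ 4 * y ^ 4 * 1) / ?N ^ 4 = ?s"
  proof -
    have "?m4 - 4 * ?N * y * ?m3 + 6 * ?N ^ 2 * y ^ 2 * ?m2 - 4 * ?N ^ 3 * y ^ 3 * ?m1
      + ?N ^ 4 * y ^ 4 * 1 = y * (1 + y) * (3 * y * (1 + y) * ?N ^ 2 + (1 + 6 * y * (1 + y)) * ?N)"
      by algebra
    moreover have "?s * ?N ^ 4 = y * (1 + y) * (3 * y * (1 + y) * ?N ^ 2 + (1 + 6 * y * (1 + y)) * ?N)"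
      using N by (simp add: field_simps power2_eq_square power3_eq_cube power4_eq_xxxx)
    ultimately show ?thesis
      using N by (metis nonzero_mult_div_cancel_right power_not_zero)
  qed
  moreover have "((baskakov_weight n y k * real k ^ 4)
      - 4 * ?N * y * (baskakov_weight n y k * real k ^ 3)
      + 6 * ?N ^ 2 * y ^ 2 * (baskakov_weight n y k * real k ^ 2)
      - 4 * ?N ^ 3 * y ^ 3 * (baskakov_weight n y k * real k)
      + ?N ^ 4 * y ^ 4 * baskakov_weight n y k) / ?N ^ 4
      = baskakov_weight n y k * (real k / ?N - y) ^ 4" for k
  proof -
    have "real k / ?N - y = (real k - ?N * y) / ?N"
      using N by (simp add: field_simps)
    then have "(real k / ?N - y) ^ 4 = (real k - ?N * y) ^ 4 / ?N ^ 4"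
      by (simp add: power_divide)
    moreover have "baskakov_weight n y k * real k ^ 4
      - 4 * ?N * y * (baskakov_weight n y k * real k ^ 3)
      + 6 * ?N ^ 2 * y ^ 2 * (baskakov_weight n y k * real k ^ 2)
      - 4 * ?N ^ 3 * y ^ 3 * (baskakov_weight n y k * real k)
      + ?N ^ 4 * y ^ 4 * baskakov_weight n y k = baskakov_weight n y k * (real k - ?N * y) ^ 4"
      by algebra
    ultimately show ?thesis
      by simp
  qed
  ultimately show ?thesis
    by simp
qed

end

section \<open>Second order Taylor expansion, with local and global control of the remainder\<close>

lemma quadratic_bound_from_derivative:
  fixes R r :: "real \<Rightarrow> real"
  assumes "convex S" "y \<in> S" "t \<in> S" "R y = 0"
    and "\<And>u. u \<in> S \<Longrightarrow> (R has_real_derivative r u) (at u within S)"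
    and "\<And>u. u \<in> S \<Longrightarrow> \<bar>r u\<bar> \<le> B * \<bar>u - y\<bar>" "B \<ge> 0"
  shows "\<bar>R t\<bar> \<le> B * (t - y) ^ 2"
proof -
  \<comment> \<open>On this convex set the linear bound on \<open>r\<close> becomes the constant
    \<open>B * \<bar>t - y\<bar>\<close>, so the mean value inequality between \<open>y\<close> and
    \<open>t\<close> gives the square.\<close>
  let ?T = "S \<inter> cball y \<bar>t - y\<bar>"
  have "norm (R t - R y) \<le> (B * \<bar>t - y\<bar>) * norm (t - y)"
  proof (rule field_differentiable_bound[of ?T R r])
    show "convex ?T"
      using assms by (intro convex_Int) auto
    show "(R has_real_derivative r u) (at u within ?T)" if "u \<in> ?T" for u
      using that assms(5) by (blast intro: has_field_derivative_subset)
    show "norm (r u) \<le> B * \<bar>t - y\<bar>" if "u \<in> ?T" for u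
    proof -
      have "B * \<bar>u - y\<bar> \<le> B * \<bar>t - y\<bar>"
        using that assms(7) by (intro mult_left_mono) (auto simp: dist_real_def)
      then show ?thesis
        using assms(6)[of u] that by simp
    qed
  qed (use assms in \<open>auto simp: dist_real_def\<close>)
  then show ?thesis
    using assms(4) by (simp add: power2_eq_square mult.assoc)
qed

text \<open>The derivative \<open>r\<close> of the remainder is bounded linearly in two ways: with
  constant \<open>2 * M\<close> everywhere, where \<open>M\<close> bounds g'', and with constant
  \<open>e\<close> near \<open>y\<close>. As g'' is not assumed continuous, the local bound comes
  from the differentiability of g' at \<open>y\<close> alone. Integrating both bounds and merging
  them gives the claim.\<close>

lemma taylor_remainder_bound:
  fixes g g' g'' :: "real \<Rightarrow> real"
  assumes "y \<ge> 0"
    and g: "\<And>u. u \<in> {0..} \<Longrightarrow> (g has_real_derivative g' u) (at u within {0..})"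
    and g': "\<And>u. u \<in> {0..} \<Longrightarrow> (g' has_real_derivative g'' u) (at u within {0..})"
    and bdd: "bounded (g'' ` {0..})"
    and "e > 0"
  obtains D where "\<And>t. t \<ge> 0 \<Longrightarrow>
    \<bar>g t - g y - g' y * (t - y) - g'' y / 2 * (t - y) ^ 2\<bar> \<le> e * (t - y) ^ 2 + D * (t - y) ^ 4"
proof -
  define R where "R = (\<lambda>t. g t - g y - g' y * (t - y) - g'' y / 2 * (t - y) ^ 2)"
  define r where "r = (\<lambda>t. g' t - g' y - g'' y * (t - y))"
  have R: "(R has_real_derivative r u) (at u within {0..})" if "u \<in> {0..}" for u
    unfolding R_def r_def using that
    by (auto intro!: derivative_eq_intros g)
  have r: "(r has_real_derivative g'' u - g'' y) (at u within {0..})" if "u \<in> {0..}" for u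
    unfolding r_def using that
    by (auto intro!: derivative_eq_intros g')
  obtain M where M: "\<And>u. u \<ge> 0 \<Longrightarrow> \<bar>g'' u\<bar> \<le> M"
    using bdd by (auto simp: bounded_iff)
  have M0: "M \<ge> 0"
    using M[of 0] by linarith
  have r_global: "\<bar>r u\<bar> \<le> 2 * M * \<bar>u - y\<bar>" if "u \<in> {0..}" for u
  proof -
    have "norm (r u - r y) \<le> 2 * M * norm (u - y)"
    proof (rule field_differentiable_bound[where f = r and S = "{0..}"])
      show "norm (g'' v - g'' y) \<le> 2 * M" if "v \<in> {0..}" for v
        using M[of v] M[of y] that assms(1) by auto
    qed (use that assms(1) r in auto)
    then show ?thesis
      by (simp add: r_def)
  qed
  have R_global: "\<bar>R t\<bar> \<le> 2 * M * (t - y) ^ 2" if "t \<ge> 0" for t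
    by (rule quadratic_bound_from_derivative[of "{0..}" y t R r])
      (use that assms(1) R r_global M0 in \<open>auto simp: R_def\<close>)
  \<comment> \<open>Both \<open>r\<close> and its derivative vanish at \<open>y\<close>, so the
    epsilon-delta form of differentiability is exactly the local linear bound.\<close>
  have "(r has_derivative (\<lambda>h. 0)) (at y within {0..})"
    using r[of y] assms(1) by (simp add: has_field_derivative_def lambda_zero)
  then obtain d where d: "d > 0" "\<And>u. u \<in> {0..} \<Longrightarrow> \<bar>u - y\<bar> < d \<Longrightarrow> \<bar>r u\<bar> \<le> e * \<bar>u - y\<bar>"
    using \<open>e > 0\<close> unfolding has_derivative_within_alt by (auto simp: r_def)
  have R_local: "\<bar>R t\<bar> \<le> e * (t - y) ^ 2" if "t \<ge> 0" "\<bar>t - y\<bar> < d" for t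
  proof (rule quadratic_bound_from_derivative[of "{0..} \<inter> ball y d" y t R r])
    show "(R has_real_derivative r u) (at u within {0..} \<inter> ball y d)" if "u \<in> {0..} \<inter> ball y d" for u
      using that R by (blast intro: has_field_derivative_subset)
  qed (use that assms(1,5) d in \<open>auto simp: R_def dist_real_def abs_minus_commute intro: convex_Int\<close>)
  show thesis
  proof
    fix t :: real
    assume t: "t \<ge> 0"
    have "\<bar>R t\<bar> \<le> e * (t - y) ^ 2 + 2 * M / d ^ 2 * (t - y) ^ 4"
    proof (cases "\<bar>t - y\<bar> < d")
      case True
      have "2 * M / d ^ 2 * (t - y) ^ 4 \<ge> 0"
        using M0 by simp
      then show ?thesis
        using R_local[OF t True] by linarith
    next
      case False
      \<comment> \<open>Away from \<open>y\<close> the factor \<open>(t - y) ^ 2 / d ^ 2\<close> is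
        at least 1; inserting it turns the global quadratic bound into the quartic term, with D =
        \<open>2 * M / d ^ 2\<close>.\<close>
      have "d ^ 2 \<le> \<bar>t - y\<bar> ^ 2"
        using False d(1) by (intro power_mono) auto
      then have "1 \<le> (t - y) ^ 2 / d ^ 2"
        using d(1) by simp
      then have "2 * M * (t - y) ^ 2 * 1 \<le> 2 * M * (t - y) ^ 2 * ((t - y) ^ 2 / d ^ 2)"
        using M0 by (intro mult_left_mono) auto
      also have "\<dots> = 2 * M / d ^ 2 * (t - y) ^ 4"
        by (simp add: power2_eq_square power4_eq_xxxx)
      finally have "\<bar>R t\<bar> \<le> 2 * M / d ^ 2 * (t - y) ^ 4"
        using R_global[OF t] by simp
      moreover have "e * (t - y) ^ 2 \<ge> 0"
        using \<open>e > 0\<close> by simp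
      ultimately show ?thesis
        by linarith
    qed
    then show "\<bar>g t - g y - g' y * (t - y) - g'' y / 2 * (t - y) ^ 2\<bar>
        \<le> e * (t - y) ^ 2 + 2 * M / d ^ 2 * (t - y) ^ 4"
      by (simp add: R_def)
  qed
qed

section \<open>Quantitative error estimate and passage to the limit\<close>

lemma baskakov_voronovskaya_error:
  fixes g :: "real \<Rightarrow> real"
  assumes y: "y \<ge> 0" and n: "n \<ge> 1"
    and bound: "\<And>t. t \<ge> 0 \<Longrightarrow> \<bar>g t - g y - a * (t - y) - b / 2 * (t - y) ^ 2\<bar>
      \<le> e * (t - y) ^ 2 + D * (t - y) ^ 4"
  shows "\<bar>real n * ((\<Sum>k. g (real k / real n) * baskakov_weight n y k) - g y)
      - 1 / 2 * y * (1 + y) * b\<bar>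
    \<le> e * (y * (1 + y))
      + D * (y * (1 + y)) * (3 * y * (1 + y) / real n + (1 + 6 * y * (1 + y)) / real n ^ 2)"
proof -
  let ?w = "baskakov_weight n y"
  let ?t = "\<lambda>k. real k / real n"
  define R where "R = (\<lambda>t. g t - g y - a * (t - y) - b / 2 * (t - y) ^ 2)"
  note m2 = baskakov_central_moment_2[OF y n] and m4 = baskakov_central_moment_4[OF y n]
  let ?B = "e * (y * (1 + y) / real n) + D * (y * (1 + y) * (3 * y * (1 + y) / real n ^ 2
      + (1 + 6 * y * (1 + y)) / real n ^ 3))"
  have B: "(\<lambda>k. e * (?w k * (?t k - y) ^ 2) + D * (?w k * (?t k - y) ^ 4)) sums ?B"
    by (intro sums_add sums_mult m2 m4)
  have le: "norm (?w k * R (?t k)) \<le> e * (?w k * (?t k - y) ^ 2) + D * (?w k * (?t k - y) ^ 4)" for k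
  proof -
    have "?w k * \<bar>R (?t k)\<bar> \<le> ?w k * (e * (?t k - y) ^ 2 + D * (?t k - y) ^ 4)"
      using bound[of "?t k"] baskakov_weight_nonneg[OF y]
      unfolding R_def by (intro mult_left_mono) auto
    then show ?thesis
      using baskakov_weight_nonneg[OF y, of n k] by (simp add: abs_mult algebra_simps)
  qed
  \<comment> \<open>Convergence of the operator series is not assumed: it follows once the remainder
    series converges, by comparison with the second and fourth central moments.\<close>
  have R: "summable (\<lambda>k. ?w k * R (?t k))"
    using B le by (intro summable_comparison_test[OF _ sums_summable[OF B]]) auto
  have R_bound: "\<bar>\<Sum>k. ?w k * R (?t k)\<bar> \<le> ?B"
    using norm_suminf_le[OF le sums_summable[OF B]] sums_unique[OF B] by simp
  \<comment> \<open>Summing the Taylor expansion termwise, with total mass 1, first central moment 0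
    and variance \<open>y * (1 + y) / real n\<close>.\<close>
  have "(\<lambda>k. g y * ?w k + a * (?w k * (?t k - y)) + b / 2 * (?w k * (?t k - y) ^ 2)
      + ?w k * R (?t k)) sums
      (g y * 1 + a * 0 + b / 2 * (y * (1 + y) / real n) + (\<Sum>k. ?w k * R (?t k)))"
    by (intro sums_add sums_mult baskakov_weight_sums_1 baskakov_central_moment_1 m2 y n
        summable_sums R)
  moreover have "g y * ?w k + a * (?w k * (?t k - y)) + b / 2 * (?w k * (?t k - y) ^ 2)
      + ?w k * R (?t k) = g (?t k) * ?w k" for k
    unfolding R_def by (simp add: algebra_simps)
  ultimately have "(\<Sum>k. g (?t k) * ?w k)
      = g y + b / 2 * (y * (1 + y) / real n) + (\<Sum>k. ?w k * R (?t k))"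
    by (simp add: sums_iff)
  then have "real n * ((\<Sum>k. g (?t k) * ?w k) - g y) - 1 / 2 * y * (1 + y) * b
      = real n * (\<Sum>k. ?w k * R (?t k))"
    using n by (simp add: field_simps)
  moreover have "\<bar>real n * (\<Sum>k. ?w k * R (?t k))\<bar> \<le> real n * ?B"
    using R_bound by (simp add: abs_mult mult_left_mono)
  moreover have "real n * ?B = e * (y * (1 + y))
      + D * (y * (1 + y)) * (3 * y * (1 + y) / real n + (1 + 6 * y * (1 + y)) / real n ^ 2)"
    using n by (simp add: field_simps power2_eq_square power3_eq_cube)
  ultimately show ?thesis
    by simp
qed

lemma baskakov_voronovskaya:
  fixes g g' g'' :: "real \<Rightarrow> real"
  assumes y: "y \<ge> 0"
    and g: "\<And>u. u \<in> {0..} \<Longrightarrow> (g has_real_derivative g' u) (at u within {0..})"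
    and g': "\<And>u. u \<in> {0..} \<Longrightarrow> (g' has_real_derivative g'' u) (at u within {0..})"
    and bdd: "bounded (g'' ` {0..})"
  shows "(\<lambda>n. real n * ((\<Sum>k. g (real k / real n) * baskakov_weight n y k) - g y))
    \<longlonglongrightarrow> 1 / 2 * y * (1 + y) * g'' y"
proof (rule LIMSEQ_I)
  fix \<epsilon> :: real
  assume \<epsilon>: "\<epsilon> > 0"
  \<comment> \<open>The extra 1 in the denominator covers \<open>y = 0\<close> and makes
    \<open>e * (y * (1 + y))\<close> strictly smaller than \<open>\<epsilon>\<close>, leaving room
    for the vanishing quartic contribution.\<close>
  define e where "e = \<epsilon> / (1 + y * (1 + y))"
  have pos: "1 + y * (1 + y) > 0"
    using y by (simp add: add_pos_nonneg)
  have e: "e > 0" "e * (y * (1 + y)) < \<epsilon>"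
    using \<epsilon> pos by (auto simp: e_def field_simps)
  obtain D where D: "\<And>t. t \<ge> 0 \<Longrightarrow>
    \<bar>g t - g y - g' y * (t - y) - g'' y / 2 * (t - y) ^ 2\<bar> \<le> e * (t - y) ^ 2 + D * (t - y) ^ 4"
    using taylor_remainder_bound[OF y g g' bdd e(1)] by blast
  have "(\<lambda>n. 1 / real n) \<longlonglongrightarrow> 0"
    by (rule lim_1_over_n)
  then have "(\<lambda>n. e * (y * (1 + y)) + D * (y * (1 + y)) *
      (3 * y * (1 + y) * (1 / real n) + (1 + 6 * y * (1 + y)) * (1 / real n) ^ 2))
      \<longlonglongrightarrow> e * (y * (1 + y)) + D * (y * (1 + y)) *
      (3 * y * (1 + y) * 0 + (1 + 6 * y * (1 + y)) * 0 ^ 2)"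
    by (intro tendsto_intros)
  then have "\<forall>\<^sub>F n in sequentially. e * (y * (1 + y)) + D * (y * (1 + y)) *
      (3 * y * (1 + y) * (1 / real n) + (1 + 6 * y * (1 + y)) * (1 / real n) ^ 2) < \<epsilon>"
    by (rule order_tendstoD) (use e(2) in simp)
  then have "\<forall>\<^sub>F n in sequentially.
      norm (real n * ((\<Sum>k. g (real k / real n) * baskakov_weight n y k) - g y)
        - 1 / 2 * y * (1 + y) * g'' y) < \<epsilon>"
    using eventually_ge_at_top[of 1]
  proof eventually_elim
    case (elim n)
    show ?case
      using baskakov_voronovskaya_error[OF y elim(2) D] elim(1) by (simp add: power_divide)
  qed
  then show "\<exists>N. \<forall>n\<ge>N. norm (real n * ((\<Sum>k. g (real k / real n) * baskakov_weight n y k) - g y)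
        - 1 / 2 * y * (1 + y) * g'' y) < \<epsilon>"
    by (simp add: eventually_sequentially)
qed

section \<open>Monotonicity of \<open>\<rho>\<close> and transfer to the generalized
  operator\<close>

lemma strict_mono_on_of_derivative_pos_within:
  fixes h h' :: "real \<Rightarrow> real"
  assumes "\<And>t. t \<in> {c..} \<Longrightarrow> (h has_real_derivative h' t) (at t within {c..})"
    and "\<And>t. t \<in> {c..} \<Longrightarrow> h' t > 0"
  shows "strict_mono_on {c..} h"
proof (rule strict_mono_onI)
  fix a b :: real
  assume ab: "a \<in> {c..}" "b \<in> {c..}" "a < b"
  \<comment> \<open>Restricting the derivative to \<open>{a..b}\<close> lets the mean value theorem
    apply also when \<open>a = c\<close>, where it is one-sided.\<close>
  have "(h has_derivative (*) (h' t)) (at t within {a..b})" if "a \<le> t" "t \<le> b" for t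
  proof -
    have "(h has_real_derivative h' t) (at t within {a..b})"
      using that ab assms(1)[of t] by (auto intro: has_field_derivative_subset)
    then show ?thesis
      by (simp add: has_field_derivative_def)
  qed
  from mvt_simple[OF \<open>a < b\<close> this]
  obtain t where t: "t \<in> {a<..<b}" "h b - h a = h' t * (b - a)"
    by blast
  have "h' t * (b - a) > 0"
    using t(1) ab assms(2)[of t] by simp
  with t(2) show "h a < h b"
    by linarith
qed

theorem theorem6:
  fixes \<rho> \<rho>' f g' g'' :: "real \<Rightarrow> real" and x :: real
  assumes "\<And>t. t \<in> {0..} \<Longrightarrow> (\<rho> has_real_derivative \<rho>' t) (at t within {0..})"
    and "continuous_on {0..} \<rho>'"
    and "\<rho> 0 = 0"
    and "1 \<le> (INF t\<in>{0..}. ereal (\<rho>' t))"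
    and "continuous_on {0..} f"
    and "x \<in> {0..}"
    and "\<And>y. y \<in> {0..} \<Longrightarrow>
           ((f \<circ> inv_into {0..} \<rho>) has_real_derivative g' y) (at y within {0..})"
    and "\<And>y. y \<in> {0..} \<Longrightarrow> (g' has_real_derivative g'' y) (at y within {0..})"
    and "bounded (g'' ` {0..})"
  shows "(\<lambda>n. real n * (gen_baskakov \<rho> n f x - f x))
           \<longlonglongrightarrow> 1 / 2 * \<rho> x * (1 + \<rho> x) * g'' (\<rho> x)"
proof -
  \<comment> \<open>In the complete lattice \<open>ereal\<close> the infimum is a lower bound
    without any side condition on boundedness.\<close>
  have "\<rho>' t > 0" if "t \<in> {0..}" for t
  proof -
    have "1 \<le> ereal (\<rho>' t)"
      using assms(4) INF_lower[OF that, of "\<lambda>t. ereal (\<rho>' t)"] by (rule order_trans)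
    then show ?thesis
      by simp
  qed
  with assms(1) have mono: "strict_mono_on {0..} \<rho>"
    by (rule strict_mono_on_of_derivative_pos_within)
  have "\<rho> x \<ge> 0"
    using strict_mono_on_leD[OF mono, of 0 x] assms(3,6) by simp
  \<comment> \<open>Strict monotonicity makes \<open>\<rho>\<close> injective on
    \<open>{0..}\<close>, so \<open>inv_into\<close> is a left inverse there.\<close>
  moreover have "(f \<circ> inv_into {0..} \<rho>) (\<rho> x) = f x"
    using assms(6) strict_mono_on_imp_inj_on[OF mono] by simp
  moreover have "gen_baskakov \<rho> n f x
      = (\<Sum>k. (f \<circ> inv_into {0..} \<rho>) (real k / real n) * baskakov_weight n (\<rho> x) k)" for n
    by (simp add: gen_baskakov_def baskakov_weight_def mult.assoc)
  ultimately show ?thesis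
    using baskakov_voronovskaya[OF _ assms(7,8,9), of "\<rho> x"] by simp
qed

end
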